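(* Let $w_h$ be a solution of the semidiscrete parabolic variational inequality and let $\mathcal W$ be its elliptic reconstruction (as in the context). Then for a.e. $t\in[0,T]$ $$\big(\nabla(\mathcal W-w_h)(t),\nabla v_h\big)=0\qquad\text{for all }v_h\in\mathcal V_h.$$
   Context: $\Omega\subset\mathbb R^d$, $d\in\{2,3\}$, is open and bounded, $T>0$, $Q=\Omega\times(0,T]$, $\mathcal V=H^1_0(\Omega)$, $(\cdot,\cdot)$ is the $L^2(\Omega)$ inner product, $a(p,q)=\int_\Omega\nabla p\cdot\nabla q\,dx$. Data: $f\in L^2(0,T;L^2(\Omega))$ and an obstacle $\chi\in H^1(Q)$ with $\chi\le0$ on $[0,T]\times\partial\Omega$. $\Omega_h$ is a shape-regular triangulation of $\Omega$ into $d$-simplices, $k\ge1$ an integer, $\mathcal V_h=\{v_h\in\mathcal V: v_h|_K\in\mathbb P_k(K)\ \forall K\in\Omega_h\}$. $\chi_h$ is an approximation of $\chi$ with $\chi_h\le0$ on $[0,T]\times\partial\Omega$, and $\mathcal K_{h,\chi}(t)=\{v_h\in\mathcal V_h: v_h|_K\ge\chi_h(t)|_K\ \forall K\in\Omega_h\}$. The discrete solution is $w_h:[0,T]\to\mathcal V_h$ (differentiable in time a.e.) with $w_h(0)=w_{h,0}\in\mathcal V_h$ given, $w_h(t)\in\mathcal K_{h,\chi}(t)$, and for a.e. $t$ $$(w_{h,t}(t),v_h-w_h(t))+a(w_h(t),v_h-w_h(t))\ge(f(t),v_h-w_h(t))\quad\forall v_h\in\mathcal K_{h,\chi}(t).$$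 The discrete multiplier $\sigma_h(t)\in\mathcal V_h$ is defined by $(\sigma_h(t),v_h)=(w_{h,t}(t),v_h)+a(w_h(t),v_h)-(f(t),v_h)$ for all $v_h\in\mathcal V_h$. Put $z_h(t)=(f+\sigma_h-w_{h,t})(t)\in L^2(\Omega)$. The elliptic reconstruction $\mathcal W(t)\in\mathcal V$ of $w_h(t)$ is the unique solution of $(\nabla\mathcal W(t),\nabla v)=(z_h(t),v)$ for all $v\in\mathcal V$. *)

theory Defs
  imports "HOL-Analysis.Analysis"
begin

text \<open>
  Elements of Lebesgue and Sobolev spaces on an open set \<open>U\<close> are represented by functions on the
  whole ambient space; only their values on \<open>U\<close>, up to null sets, matter.
\<close>

definition L2 :: "'a::euclidean_space set \<Rightarrow> ('a \<Rightarrow> 'b::euclidean_space) set" where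
  "L2 U = {u. set_borel_measurable lebesgue U u \<and> set_integrable lebesgue U (\<lambda>x. (norm (u x))\<^sup>2)}"

definition L2_inner ::
    "'a::euclidean_space set \<Rightarrow> ('a \<Rightarrow> 'b::euclidean_space) \<Rightarrow> ('a \<Rightarrow> 'b) \<Rightarrow> real" where
  "L2_inner U u v = (LINT x:U|lebesgue. u x \<bullet> v x)"

definition L2_norm :: "'a::euclidean_space set \<Rightarrow> ('a \<Rightarrow> 'b::euclidean_space) \<Rightarrow> real" where
  "L2_norm U u = sqrt (L2_inner U u u)"

definition partial :: "'a::euclidean_space \<Rightarrow> ('a \<Rightarrow> real) \<Rightarrow> 'a \<Rightarrow> real" where
  "partial i \<phi> x = frechet_derivative \<phi> (at x) i"

definition gradient :: "('a::euclidean_space \<Rightarrow> real) \<Rightarrow> 'a \<Rightarrow> 'a" where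
  "gradient \<phi> x = (\<Sum>i\<in>Basis. partial i \<phi> x *\<^sub>R i)"

definition smooth :: "('a::euclidean_space \<Rightarrow> real) \<Rightarrow> bool" where
  "smooth \<phi> \<longleftrightarrow> (\<forall>is. set is \<subseteq> Basis \<longrightarrow> (\<forall>x. (foldr partial is \<phi>) differentiable (at x)))"

definition test_functions :: "'a::euclidean_space set \<Rightarrow> ('a \<Rightarrow> real) set" where
  "test_functions U =
    {\<phi>. smooth \<phi> \<and> compact (closure {x. \<phi> x \<noteq> 0}) \<and> closure {x. \<phi> x \<noteq> 0} \<subseteq> U}"

definition has_weak_gradient ::
    "'a::euclidean_space set \<Rightarrow> ('a \<Rightarrow> real) \<Rightarrow> ('a \<Rightarrow> 'a) \<Rightarrow> bool" where
  "has_weak_gradient U u G \<longleftrightarrow> G \<in> L2 U \<and>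
    (\<forall>\<phi>\<in>test_functions U. \<forall>i\<in>Basis.
       (LINT x:U|lebesgue. u x * partial i \<phi> x) = - (LINT x:U|lebesgue. (G x \<bullet> i) * \<phi> x))"

definition H1 :: "'a::euclidean_space set \<Rightarrow> ('a \<Rightarrow> real) set" where
  "H1 U = {u \<in> L2 U. \<exists>G. has_weak_gradient U u G}"

text \<open>A representative of the weak gradient of \<open>u \<in> H1 U\<close>, which is unique up to null sets.\<close>

definition weak_gradient :: "'a::euclidean_space set \<Rightarrow> ('a \<Rightarrow> real) \<Rightarrow> 'a \<Rightarrow> 'a" where
  "weak_gradient U u = (SOME G. has_weak_gradient U u G)"

definition H10 :: "'a::euclidean_space set \<Rightarrow> ('a \<Rightarrow> real) set" where
  "H10 U = {u \<in> H1 U. \<exists>\<phi>. (\<forall>n::nat. \<phi> n \<in> test_functions U) \<and>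
     (\<lambda>n. L2_norm U (\<lambda>x. u x - \<phi> n x)) \<longlonglongrightarrow> 0 \<and>
     (\<lambda>n. L2_norm U (\<lambda>x. weak_gradient U u x - gradient (\<phi> n) x)) \<longlonglongrightarrow> 0}"

definition dirichlet_form ::
    "'a::euclidean_space set \<Rightarrow> ('a \<Rightarrow> real) \<Rightarrow> ('a \<Rightarrow> real) \<Rightarrow> real" where
  "dirichlet_form U p q = L2_inner U (weak_gradient U p) (weak_gradient U q)"

text \<open>
  \<open>u \<le> 0\<close> on a part \<open>E\<close> of the boundary of \<open>U\<close>, for \<open>u \<in> H1 U\<close>: the positive part of \<open>u\<close> is the
  limit in \<open>H1 U\<close> of functions vanishing near \<open>E\<close>. This is the usual meaning of the
  inequality when no regularity of the boundary is available for a trace operator.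
\<close>

definition H1_nonpos_on :: "'a::euclidean_space set \<Rightarrow> 'a set \<Rightarrow> ('a \<Rightarrow> real) \<Rightarrow> bool" where
  "H1_nonpos_on U E u \<longleftrightarrow>
    (\<exists>\<phi>. (\<forall>n::nat. \<phi> n \<in> H1 U \<and> (\<exists>N. open N \<and> E \<subseteq> N \<and> (\<forall>x\<in>U \<inter> N. \<phi> n x = 0))) \<and>
       (\<lambda>n. L2_norm U (\<lambda>x. max (u x) 0 - \<phi> n x)) \<longlonglongrightarrow> 0 \<and>
       (\<lambda>n. L2_norm U (\<lambda>x. weak_gradient U (\<lambda>y. max (u y) 0) x - weak_gradient U (\<phi> n) x))
         \<longlonglongrightarrow> 0)"

text \<open>The Bochner space \<open>L\<^sup>2(0,T; L\<^sup>2(U))\<close>; strong measurability is approximation by simple functions.\<close>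

definition simple_L2 :: "real \<Rightarrow> 'a::euclidean_space set \<Rightarrow> (real \<Rightarrow> 'a \<Rightarrow> real) \<Rightarrow> bool" where
  "simple_L2 T U s \<longleftrightarrow> finite (s ` {0<..<T}) \<and>
    (\<forall>g \<in> s ` {0<..<T}. g \<in> L2 U \<and> {t \<in> {0<..<T}. s t = g} \<in> sets lebesgue)"

definition Bochner_L2_L2 ::
    "real \<Rightarrow> 'a::euclidean_space set \<Rightarrow> (real \<Rightarrow> 'a \<Rightarrow> real) set" where
  "Bochner_L2_L2 T U = {f.
     (AE t\<in>{0<..<T} in lebesgue. f t \<in> L2 U) \<and>
     (\<exists>s. (\<forall>n::nat. simple_L2 T U (s n)) \<and>
        (AE t\<in>{0<..<T} in lebesgue. (\<lambda>n. L2_norm U (\<lambda>x. s n t x - f t x)) \<longlonglongrightarrow> 0)) \<and>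
     set_integrable lebesgue {0<..<T} (\<lambda>t. (L2_norm U (f t))\<^sup>2)}"

text \<open>\<open>g\<close> is the derivative at \<open>t\<close> of \<open>w : [0,T] \<rightarrow> L\<^sup>2(U)\<close>; on a finite-dimensional subspace all
  norms give the same notion.\<close>

definition has_time_derivative ::
    "real \<Rightarrow> 'a::euclidean_space set \<Rightarrow> (real \<Rightarrow> 'a \<Rightarrow> real) \<Rightarrow> ('a \<Rightarrow> real) \<Rightarrow> real \<Rightarrow> bool" where
  "has_time_derivative T U w g t \<longleftrightarrow>
    ((\<lambda>s. L2_norm U (\<lambda>x. (w s x - w t x) / (s - t) - g x)) \<longlongrightarrow> 0) (at t within {0..T})"

definition polynomials_upto :: "nat \<Rightarrow> (real ^ 'd \<Rightarrow> real) set" where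
  "polynomials_upto k = {p. \<exists>c :: ('d \<Rightarrow> nat) \<Rightarrow> real. \<forall>x.
     p x = (\<Sum>\<alpha> | (\<Sum>i\<in>UNIV. \<alpha> i) \<le> k. c \<alpha> * (\<Prod>i\<in>UNIV. (x $ i) ^ \<alpha> i))}"

definition inradius :: "'a::euclidean_space set \<Rightarrow> real" where
  "inradius K = Sup {r. \<exists>x. cball x r \<subseteq> K}"

text \<open>Shape regularity, a uniform bound over a family of meshes, appears through its constant \<open>\<kappa>\<close>.\<close>

definition shape_regular_triangulation ::
    "real \<Rightarrow> (real ^ 'd) set \<Rightarrow> (real ^ 'd) set set \<Rightarrow> bool" where
  "shape_regular_triangulation \<kappa> \<Omega> \<T> \<longleftrightarrow>
    triangulation \<T> \<and> (\<forall>K\<in>\<T>. int CARD('d) simplex K) \<and> \<Union>\<T> = closure \<Omega> \<and>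
    (\<forall>K\<in>\<T>. diameter K \<le> \<kappa> * inradius K)"

text \<open>The elements of the finite element space are represented by their continuous
  representatives: the closed simplices overlap on faces, where the polynomials have to agree.\<close>

definition fe_space :: "(real ^ 'd) set \<Rightarrow> (real ^ 'd) set set \<Rightarrow> nat \<Rightarrow> (real ^ 'd \<Rightarrow> real) set" where
  "fe_space \<Omega> \<T> k = {v \<in> H10 \<Omega>. \<forall>K\<in>\<T>. \<exists>p\<in>polynomials_upto k. \<forall>x\<in>K. v x = p x}"

definition constraint_set ::
    "(real ^ 'd) set \<Rightarrow> (real ^ 'd) set set \<Rightarrow> nat \<Rightarrow> (real \<Rightarrow> real ^ 'd \<Rightarrow> real) \<Rightarrow> real
      \<Rightarrow> (real ^ 'd \<Rightarrow> real) set" where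
  "constraint_set \<Omega> \<T> k \<psi>h t = {v \<in> fe_space \<Omega> \<T> k. \<forall>K\<in>\<T>. \<forall>x\<in>K. v x \<ge> \<psi>h t x}"

text \<open>\<open>wt\<close> is the time derivative of \<open>w\<close> and \<open>w0\<close> the initial value.\<close>

definition semidiscrete_solution ::
    "(real ^ 'd) set \<Rightarrow> real \<Rightarrow> (real \<Rightarrow> real ^ 'd \<Rightarrow> real) \<Rightarrow> (real ^ 'd) set set \<Rightarrow> nat
      \<Rightarrow> (real \<Rightarrow> real ^ 'd \<Rightarrow> real) \<Rightarrow> (real ^ 'd \<Rightarrow> real)
      \<Rightarrow> (real \<Rightarrow> real ^ 'd \<Rightarrow> real) \<Rightarrow> (real \<Rightarrow> real ^ 'd \<Rightarrow> real) \<Rightarrow> bool" where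
  "semidiscrete_solution \<Omega> T f \<T> k \<psi>h w0 w wt \<longleftrightarrow>
    (\<forall>t\<in>{0..T}. w t \<in> constraint_set \<Omega> \<T> k \<psi>h t) \<and>
    (\<forall>x\<in>closure \<Omega>. w 0 x = w0 x) \<and>
    (AE t\<in>{0..T} in lebesgue. wt t \<in> fe_space \<Omega> \<T> k \<and> has_time_derivative T \<Omega> w (wt t) t) \<and>
    (AE t\<in>{0..T} in lebesgue. \<forall>v\<in>constraint_set \<Omega> \<T> k \<psi>h t.
       L2_inner \<Omega> (wt t) (\<lambda>x. v x - w t x) + dirichlet_form \<Omega> (w t) (\<lambda>x. v x - w t x)
         \<ge> L2_inner \<Omega> (f t) (\<lambda>x. v x - w t x))"

definition discrete_multiplier ::
    "(real ^ 'd) set \<Rightarrow> real \<Rightarrow> (real \<Rightarrow> real ^ 'd \<Rightarrow> real) \<Rightarrow> (real ^ 'd) set set \<Rightarrow> nat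
      \<Rightarrow> (real \<Rightarrow> real ^ 'd \<Rightarrow> real) \<Rightarrow> (real \<Rightarrow> real ^ 'd \<Rightarrow> real)
      \<Rightarrow> (real \<Rightarrow> real ^ 'd \<Rightarrow> real) \<Rightarrow> bool" where
  "discrete_multiplier \<Omega> T f \<T> k w wt \<sigma> \<longleftrightarrow>
    (AE t\<in>{0..T} in lebesgue. \<sigma> t \<in> fe_space \<Omega> \<T> k \<and>
       (\<forall>v\<in>fe_space \<Omega> \<T> k. L2_inner \<Omega> (\<sigma> t) v =
          L2_inner \<Omega> (wt t) v + dirichlet_form \<Omega> (w t) v - L2_inner \<Omega> (f t) v))"

definition elliptic_reconstruction ::
    "(real ^ 'd) set \<Rightarrow> real \<Rightarrow> (real \<Rightarrow> real ^ 'd \<Rightarrow> real) \<Rightarrow> (real \<Rightarrow> real ^ 'd \<Rightarrow> real)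
      \<Rightarrow> (real \<Rightarrow> real ^ 'd \<Rightarrow> real) \<Rightarrow> (real \<Rightarrow> real ^ 'd \<Rightarrow> real) \<Rightarrow> bool" where
  "elliptic_reconstruction \<Omega> T f wt \<sigma> W \<longleftrightarrow>
    (AE t\<in>{0..T} in lebesgue. W t \<in> H10 \<Omega> \<and>
       (\<forall>v\<in>H10 \<Omega>. L2_inner \<Omega> (weak_gradient \<Omega> (W t)) (weak_gradient \<Omega> v) =
          L2_inner \<Omega> (\<lambda>x. f t x + \<sigma> t x - wt t x) v))"

end

theory Submission
  imports Defs
begin

text \<open>
  Fix a time \<open>t\<close> outside the exceptional null sets and \<open>v\<close> in the finite element space, which lies in
  \<open>H10 \<Omega>\<close>. Testing the elliptic reconstruction with \<open>v\<close> and then inserting the definition of the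
  discrete multiplier gives
  \<open>(\<nabla>W, \<nabla>v) = (f + \<sigma> - wt, v) = (f, v) - (wt, v) + ((wt, v) + a(w, v) - (f, v)) = (\<nabla>w, \<nabla>v)\<close>,
  so that \<open>w\<close> is the Galerkin approximation of \<open>W\<close>.

  What needs care is that \<open>weak_gradient\<close> selects some weak gradient of each function, so that the
  one selected for \<open>W - w\<close> need not be \<open>\<nabla>W - \<nabla>w\<close> pointwise. Almost everywhere uniqueness of weak
  gradients would settle this, but less is enough: two weak gradients \<open>G\<close>, \<open>G'\<close> of the same function
  have the same inner product with \<open>\<nabla>v\<close> for every \<open>v \<in> H10 \<Omega>\<close>. If \<open>\<phi>\<close> is a test function, each
  \<open>\<partial>\<^sub>i \<phi>\<close> is again one, so testing against it shows that \<open>G\<close> and \<open>G'\<close> have the same inner product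
  with \<open>\<nabla>\<phi>\<close> (\<open>has_weak_gradient_inner_gradient_test\<close>); the claim for \<open>v\<close> follows by density and the
  Cauchy--Schwarz inequality (\<open>has_weak_gradient_inner_unique\<close>). This route avoids mollifiers.
\<close>

section \<open>Square integrable functions\<close>

lemma set_integrable_inner_L2:
  fixes u v :: "'a::euclidean_space \<Rightarrow> 'b::euclidean_space"
  assumes "u \<in> L2 U" "v \<in> L2 U"
  shows "set_integrable lebesgue U (\<lambda>x. u x \<bullet> v x)"
proof -
  have mu: "(\<lambda>x. indicator U x *\<^sub>R u x) \<in> borel_measurable lebesgue"
    and mv: "(\<lambda>x. indicator U x *\<^sub>R v x) \<in> borel_measurable lebesgue"
    using assms by (auto simp: L2_def set_borel_measurable_def)
  have eq: "(\<lambda>x. indicator U x *\<^sub>R (u x \<bullet> v x))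
      = (\<lambda>x. (indicator U x *\<^sub>R u x) \<bullet> (indicator U x *\<^sub>R v x))"
    by (auto simp: indicator_def)
  have m: "(\<lambda>x. indicator U x *\<^sub>R (u x \<bullet> v x)) \<in> borel_measurable lebesgue"
    unfolding eq by (rule borel_measurable_inner[OF mu mv])
  have i: "integrable lebesgue (\<lambda>x. indicator U x *\<^sub>R (norm (u x))\<^sup>2 + indicator U x *\<^sub>R (norm (v x))\<^sup>2)"
    using assms by (auto simp: L2_def set_integrable_def)
  have b: "\<bar>u x \<bullet> v x\<bar> \<le> (norm (u x))\<^sup>2 + (norm (v x))\<^sup>2" for x
  proof -
    have "\<bar>u x \<bullet> v x\<bar> \<le> norm (u x) * norm (v x)" by (rule Cauchy_Schwarz_ineq2)
    also have "\<dots> \<le> (norm (u x))\<^sup>2 + (norm (v x))\<^sup>2"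
      using sum_squares_bound[of "norm (u x)" "norm (v x)"]
        mult_nonneg_nonneg[OF norm_ge_zero norm_ge_zero, of "u x" "v x"] by linarith
    finally show ?thesis .
  qed
  show ?thesis unfolding set_integrable_def
    by (rule Bochner_Integration.integrable_bound[OF i m]) (use b in \<open>auto simp: indicator_def\<close>)
qed

lemma L2_iff:
  fixes u :: "'a::euclidean_space \<Rightarrow> 'b::euclidean_space"
  shows "u \<in> L2 U \<longleftrightarrow> set_borel_measurable lebesgue U u \<and> set_integrable lebesgue U (\<lambda>x. u x \<bullet> u x)"
  by (simp add: L2_def power2_norm_eq_inner)

lemma L2_scaleR:
  fixes u :: "'a::euclidean_space \<Rightarrow> 'b::euclidean_space"
  assumes "u \<in> L2 U"
  shows "(\<lambda>x. c *\<^sub>R u x) \<in> L2 U"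
proof -
  have "(\<lambda>x. c *\<^sub>R (indicator U x *\<^sub>R u x)) \<in> borel_measurable lebesgue"
    by (rule borel_measurable_scaleR) (use assms in \<open>auto simp: L2_def set_borel_measurable_def\<close>)
  moreover have "integrable lebesgue (\<lambda>x. c\<^sup>2 *\<^sub>R (indicator U x *\<^sub>R (norm (u x))\<^sup>2))"
    using assms by (intro integrable_scaleR_right) (simp add: L2_def set_integrable_def)
  ultimately show ?thesis
    by (simp add: L2_def set_borel_measurable_def set_integrable_def power_mult_distrib ac_simps)
qed

lemma L2_add:
  fixes u v :: "'a::euclidean_space \<Rightarrow> 'b::euclidean_space"
  assumes "u \<in> L2 U" "v \<in> L2 U"
  shows "(\<lambda>x. u x + v x) \<in> L2 U"
proof -
  have "(\<lambda>x. indicator U x *\<^sub>R u x + indicator U x *\<^sub>R v x) \<in> borel_measurable lebesgue"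
    using assms by (intro borel_measurable_add) (auto simp: L2_def set_borel_measurable_def)
  then have "set_borel_measurable lebesgue U (\<lambda>x. u x + v x)"
    by (simp add: set_borel_measurable_def scaleR_add_right)
  moreover have "set_integrable lebesgue U (\<lambda>x. (u x \<bullet> u x + u x \<bullet> v x) + (v x \<bullet> u x + v x \<bullet> v x))"
    using assms by (intro set_integral_add(1) set_integrable_inner_L2)
  ultimately show ?thesis
    by (simp add: L2_iff inner_add_left inner_add_right algebra_simps)
qed

lemma L2_diff:
  fixes u v :: "'a::euclidean_space \<Rightarrow> 'b::euclidean_space"
  assumes "u \<in> L2 U" "v \<in> L2 U"
  shows "(\<lambda>x. u x - v x) \<in> L2 U"
  using L2_add[OF assms(1) L2_scaleR[OF assms(2), of "-1"]] by simp

lemma L2_scaleR_const: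
  fixes g :: "'a::euclidean_space \<Rightarrow> real" and i :: "'b::euclidean_space"
  assumes "g \<in> L2 U"
  shows "(\<lambda>x. g x *\<^sub>R i) \<in> L2 U"
proof -
  have "(\<lambda>x. (indicator U x *\<^sub>R g x) *\<^sub>R i) \<in> borel_measurable lebesgue"
    by (rule borel_measurable_scaleR) (use assms in \<open>auto simp: L2_def set_borel_measurable_def\<close>)
  moreover have "integrable lebesgue (\<lambda>x. (norm i)\<^sup>2 *\<^sub>R (indicator U x *\<^sub>R (norm (g x))\<^sup>2))"
    using assms by (intro integrable_scaleR_right) (simp add: L2_def set_integrable_def)
  ultimately show ?thesis
    by (simp add: L2_def set_borel_measurable_def set_integrable_def power_mult_distrib ac_simps)
qed

lemma L2_sum:
  fixes u :: "'c \<Rightarrow> 'a::euclidean_space \<Rightarrow> 'b::euclidean_space"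
  assumes "finite I" "\<And>i. i \<in> I \<Longrightarrow> u i \<in> L2 U"
  shows "(\<lambda>x. \<Sum>i\<in>I. u i x) \<in> L2 U"
  using assms
proof (induction I rule: finite_induct)
  case empty
  show ?case by (simp add: L2_def set_borel_measurable_def set_integrable_def)
next
  case (insert i I)
  then show ?case by (simp add: L2_add)
qed

lemma L2_component:
  fixes G :: "'a::euclidean_space \<Rightarrow> 'b::euclidean_space"
  assumes "G \<in> L2 U" "i \<in> Basis"
  shows "(\<lambda>x. G x \<bullet> i) \<in> L2 U"
proof -
  have "(\<lambda>x. (indicator U x *\<^sub>R G x) \<bullet> i) \<in> borel_measurable lebesgue"
    using assms by (intro borel_measurable_inner borel_measurable_const)
      (simp add: L2_def set_borel_measurable_def)
  then have m: "set_borel_measurable lebesgue U (\<lambda>x. G x \<bullet> i)"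
    by (simp add: set_borel_measurable_def)
  have "integrable lebesgue (\<lambda>x. indicator U x *\<^sub>R (norm (G x \<bullet> i))\<^sup>2)"
  proof (rule Bochner_Integration.integrable_bound)
    show "integrable lebesgue (\<lambda>x. indicator U x *\<^sub>R (norm (G x))\<^sup>2)"
      using assms by (simp add: L2_def set_integrable_def)
    have "(\<lambda>x. (norm (indicator U x *\<^sub>R (G x \<bullet> i)))\<^sup>2) \<in> borel_measurable lebesgue"
      using m by (intro borel_measurable_power borel_measurable_norm)
        (simp add: set_borel_measurable_def)
    moreover have "(\<lambda>x. (norm (indicator U x *\<^sub>R (G x \<bullet> i)))\<^sup>2)
        = (\<lambda>x. indicator U x *\<^sub>R (norm (G x \<bullet> i))\<^sup>2)"
      by (auto simp: indicator_def)
    ultimately show "(\<lambda>x. indicator U x *\<^sub>R (norm (G x \<bullet> i))\<^sup>2) \<in> borel_measurable lebesgue"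
      by simp
    have "(G x \<bullet> i)\<^sup>2 \<le> (norm (G x))\<^sup>2" for x
      using Basis_le_norm[OF assms(2), of "G x"] by (metis abs_ge_zero power2_abs power_mono)
    then show "AE x in lebesgue. norm (indicator U x *\<^sub>R (norm (G x \<bullet> i))\<^sup>2)
        \<le> norm (indicator U x *\<^sub>R (norm (G x))\<^sup>2)"
      by (auto simp: indicator_def)
  qed
  with m show ?thesis by (simp add: L2_def set_integrable_def)
qed

lemma L2_inner_real: "L2_inner U u (v :: 'a::euclidean_space \<Rightarrow> real) = (LINT x:U|lebesgue. u x * v x)"
  by (simp add: L2_inner_def)

lemma L2_inner_commute: "L2_inner U u v = L2_inner U v u"
  by (simp add: L2_inner_def inner_commute)

lemma L2_inner_add_left:
  assumes "u \<in> L2 U" "v \<in> L2 U" "z \<in> L2 U"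
  shows "L2_inner U (\<lambda>x. u x + v x) z = L2_inner U u z + L2_inner U v z"
  unfolding L2_inner_def inner_add_left
  by (rule set_integral_add(2)[OF set_integrable_inner_L2 set_integrable_inner_L2]) (use assms in auto)

lemma L2_inner_diff_left:
  assumes "u \<in> L2 U" "v \<in> L2 U" "z \<in> L2 U"
  shows "L2_inner U (\<lambda>x. u x - v x) z = L2_inner U u z - L2_inner U v z"
  unfolding L2_inner_def inner_diff_left
  by (rule set_integral_diff(2)[OF set_integrable_inner_L2 set_integrable_inner_L2]) (use assms in auto)

lemma L2_inner_diff_right:
  assumes "u \<in> L2 U" "v \<in> L2 U" "z \<in> L2 U"
  shows "L2_inner U z (\<lambda>x. u x - v x) = L2_inner U z u - L2_inner U z v"
  using L2_inner_diff_left[OF assms] by (simp add: L2_inner_commute)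

lemma L2_inner_scaleR_left: "L2_inner U (\<lambda>x. c *\<^sub>R u x) v = c * L2_inner U u v"
  by (simp add: L2_inner_def)

lemma L2_inner_scaleR_right: "L2_inner U u (\<lambda>x. c *\<^sub>R v x) = c * L2_inner U u v"
  by (simp add: L2_inner_def)

lemma L2_inner_self_nonneg: "0 \<le> L2_inner U u u"
  unfolding L2_inner_def set_lebesgue_integral_def
  by (rule Bochner_Integration.integral_nonneg) (simp add: indicator_def)

text \<open>\<open>(u - s v, u - s v)\<close> is a quadratic in \<open>s\<close> that is nowhere negative. Its minimum gives the
  bound if \<open>(v, v) > 0\<close>; otherwise it is affine, hence constant, so \<open>(u, v) = 0\<close>.\<close>

lemma L2_Cauchy_Schwarz:
  assumes u: "u \<in> L2 U" and v: "v \<in> L2 U"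
  shows "\<bar>L2_inner U u v\<bar> \<le> L2_norm U u * L2_norm U v"
proof -
  define A B C where "A = L2_inner U u u" and "B = L2_inner U u v" and "C = L2_inner U v v"
  have quad: "0 \<le> A - 2 * s * B + s\<^sup>2 * C" for s
  proof -
    have sv: "(\<lambda>x. s *\<^sub>R v x) \<in> L2 U" by (rule L2_scaleR[OF v])
    let ?d = "\<lambda>x. u x - s *\<^sub>R v x"
    have "L2_inner U ?d ?d = L2_inner U u ?d - s * L2_inner U v ?d"
      using L2_inner_diff_left[OF u sv L2_diff[OF u sv]] by (simp add: L2_inner_scaleR_left)
    also have "L2_inner U u ?d = A - s * B"
      using L2_inner_diff_right[OF u sv u] by (simp add: L2_inner_scaleR_right A_def B_def)
    also have "L2_inner U v ?d = B - s * C"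
      using L2_inner_diff_right[OF u sv v] L2_inner_commute[of U v u]
      by (simp add: L2_inner_scaleR_right B_def C_def)
    finally have "L2_inner U ?d ?d = A - 2 * s * B + s\<^sup>2 * C"
      by (simp add: power2_eq_square algebra_simps)
    then show ?thesis using L2_inner_self_nonneg[of U "\<lambda>x. u x - s *\<^sub>R v x"] by simp
  qed
  have C0: "C \<ge> 0" unfolding C_def by (rule L2_inner_self_nonneg)
  have "B\<^sup>2 \<le> A * C"
  proof (cases "C = 0")
    case True
    have "B = 0"
    proof (rule ccontr)
      \<comment> \<open>The quadratic is affine with nonzero slope; this \<open>s\<close> makes its value \<open>-1\<close>.\<close>
      assume "B \<noteq> 0"
      then show False using quad[of "(A + 1) / (2 * B)"] True by simp
    qed
    with True show ?thesis by simp
  next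
    case False
    with C0 have "C > 0" by simp
    then show ?thesis using quad[of "B / C"] by (simp add: field_simps power2_eq_square)
  qed
  then have "sqrt (B\<^sup>2) \<le> sqrt (A * C)" by (rule real_sqrt_le_mono)
  then show ?thesis by (simp add: L2_norm_def A_def B_def C_def real_sqrt_mult)
qed

lemma L2_inner_tendsto:
  assumes z: "z \<in> L2 U" and u: "u \<in> L2 U" and un: "\<And>n. un n \<in> L2 U"
    and lim: "(\<lambda>n. L2_norm U (\<lambda>x. u x - un n x)) \<longlonglongrightarrow> 0"
  shows "(\<lambda>n. L2_inner U z (un n)) \<longlonglongrightarrow> L2_inner U z u"
proof -
  have "(\<lambda>n. L2_inner U z u - L2_inner U z (un n)) \<longlonglongrightarrow> 0"
  proof (rule Lim_null_comparison)
    show "(\<lambda>n. L2_norm U z * L2_norm U (\<lambda>x. u x - un n x)) \<longlonglongrightarrow> 0"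
      using tendsto_mult_right_zero[OF lim] .
    show "\<forall>\<^sub>F n in sequentially. norm (L2_inner U z u - L2_inner U z (un n))
        \<le> L2_norm U z * L2_norm U (\<lambda>x. u x - un n x)"
      using L2_Cauchy_Schwarz[OF z L2_diff[OF u un]]
      by (simp add: L2_inner_diff_right[OF u un z])
  qed
  then have "(\<lambda>n. L2_inner U z u - (L2_inner U z u - L2_inner U z (un n))) \<longlonglongrightarrow> L2_inner U z u - 0"
    by (intro tendsto_diff tendsto_const)
  then show ?thesis by simp
qed

section \<open>Test functions\<close>

lemma continuous_compact_support_L2:
  fixes g :: "'a::euclidean_space \<Rightarrow> 'b::euclidean_space"
  assumes "open U" and g: "continuous_on UNIV g" and K: "compact K" "K \<subseteq> U"
    and zero: "\<And>x. x \<notin> K \<Longrightarrow> g x = 0"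
  shows "g \<in> L2 U"
proof -
  have "(\<lambda>x. indicator U x *\<^sub>R g x) \<in> borel_measurable borel"
    using \<open>open U\<close> g by (intro borel_measurable_scaleR borel_measurable_indicator
        borel_measurable_continuous_onI) auto
  then have "set_borel_measurable lebesgue U g"
    unfolding set_borel_measurable_def by (intro measurable_completion) simp
  moreover have "integrable lborel (\<lambda>x. indicator K x *\<^sub>R (norm (g x))\<^sup>2)"
    by (intro borel_integrable_compact K continuous_intros continuous_on_subset[OF g]) auto
  then have "integrable lebesgue (\<lambda>x. indicator K x *\<^sub>R (norm (g x))\<^sup>2)"
    by (subst integrable_completion) auto
  moreover have "(\<lambda>x. indicator K x *\<^sub>R (norm (g x))\<^sup>2) = (\<lambda>x. indicator U x *\<^sub>R (norm (g x))\<^sup>2)"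
    using K(2) zero by (fastforce simp: indicator_def)
  ultimately show ?thesis by (simp add: L2_def set_integrable_def)
qed

lemma smooth_partial:
  assumes "smooth \<phi>" "i \<in> Basis"
  shows "smooth (partial i \<phi>)"
  unfolding smooth_def
proof (intro allI impI)
  fix "is" :: "'a list" and x :: 'a
  assume "set is \<subseteq> Basis"
  then have "foldr partial (is @ [i]) \<phi> differentiable (at x)"
    using assms unfolding smooth_def by (metis Un_insert_right empty_set insert_subset list.simps(15)
        set_append sup_bot_right)
  then show "foldr partial is (partial i \<phi>) differentiable (at x)" by simp
qed

lemma smooth_continuous:
  assumes "smooth \<phi>"
  shows "continuous_on UNIV \<phi>"
proof -
  have "\<forall>x. foldr partial [] \<phi> differentiable (at x)"
    using assms unfolding smooth_def by (metis empty_set empty_subsetI)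
  then show ?thesis
    by (simp add: continuous_at_imp_continuous_on differentiable_imp_continuous_within)
qed

lemma test_functions_L2:
  assumes "open U" "\<phi> \<in> test_functions U"
  shows "\<phi> \<in> L2 U"
proof (rule continuous_compact_support_L2[OF \<open>open U\<close>])
  show "\<phi> x = 0" if "x \<notin> closure {x. \<phi> x \<noteq> 0}" for x
    using that closure_subset[of "{x. \<phi> x \<noteq> 0}"] by blast
qed (use assms in \<open>auto simp: test_functions_def intro: smooth_continuous\<close>)

text \<open>Off its support a function vanishes in a neighbourhood, so its partial derivatives vanish
  there as well and differentiation does not enlarge the support.\<close>

lemma partial_test_functions:
  assumes \<phi>: "\<phi> \<in> test_functions U" and i: "i \<in> Basis"
  shows "partial i \<phi> \<in> test_functions U"
proof -
  let ?S = "closure {x. \<phi> x \<noteq> 0}"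
  have zero: "partial i \<phi> x = 0" if x: "x \<notin> ?S" for x
  proof -
    have "((\<lambda>_. 0) has_derivative (\<lambda>_. 0)) (at x)" by simp
    then have "(\<phi> has_derivative (\<lambda>_. 0)) (at x)"
    proof (rule has_derivative_transform_within_open)
      show "open (- ?S)" by (simp add: open_Compl)
      show "x \<in> - ?S" using x by simp
      show "0 = \<phi> y" if "y \<in> - ?S" for y
        using that closure_subset[of "{x. \<phi> x \<noteq> 0}"] by auto
    qed
    then have "frechet_derivative \<phi> (at x) = (\<lambda>_. 0)"
      using frechet_derivative_at by metis
    then show ?thesis by (simp add: partial_def)
  qed
  then have "{x. partial i \<phi> x \<noteq> 0} \<subseteq> ?S" by blast
  then have sub: "closure {x. partial i \<phi> x \<noteq> 0} \<subseteq> ?S" by (simp add: closure_minimal)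
  moreover have "compact (closure {x. partial i \<phi> x \<noteq> 0})"
    using \<phi> sub compact_Int_closed[of ?S "closure {x. partial i \<phi> x \<noteq> 0}"]
    by (simp add: test_functions_def Int_absorb1)
  ultimately show ?thesis
    using \<phi> i smooth_partial by (auto simp: test_functions_def)
qed

lemma gradient_test_function_L2:
  assumes "open U" "\<phi> \<in> test_functions U"
  shows "gradient \<phi> \<in> L2 U"
proof -
  have "(\<lambda>x. \<Sum>i\<in>Basis. partial i \<phi> x *\<^sub>R i) \<in> L2 U"
    using assms by (intro L2_sum L2_scaleR_const test_functions_L2 partial_test_functions) auto
  then show ?thesis by (simp add: gradient_def[abs_def])
qed

section \<open>Weak gradients\<close>

lemma has_weak_gradient_weak_gradient:
  "u \<in> H1 U \<Longrightarrow> has_weak_gradient U u (weak_gradient U u)"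
  unfolding weak_gradient_def H1_def by (metis (mono_tags, lifting) mem_Collect_eq someI_ex)

lemma has_weak_gradient_diff:
  assumes "open U" and u: "u \<in> L2 U" and v: "v \<in> L2 U"
    and G: "has_weak_gradient U u G" and H: "has_weak_gradient U v H"
  shows "has_weak_gradient U (\<lambda>x. u x - v x) (\<lambda>x. G x - H x)"
  unfolding has_weak_gradient_def
proof (intro conjI ballI)
  have GL: "G \<in> L2 U" and HL: "H \<in> L2 U" using G H by (auto simp: has_weak_gradient_def)
  then show "(\<lambda>x. G x - H x) \<in> L2 U" by (rule L2_diff)
  fix \<phi> i assume \<phi>: "\<phi> \<in> test_functions U" and i: "(i::'a) \<in> Basis"
  have "L2_inner U (\<lambda>x. u x - v x) (partial i \<phi>)
      = L2_inner U u (partial i \<phi>) - L2_inner U v (partial i \<phi>)"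
    by (intro L2_inner_diff_left u v test_functions_L2 partial_test_functions \<open>open U\<close> \<phi> i)
  also have "\<dots> = - (L2_inner U (\<lambda>x. G x \<bullet> i) \<phi> - L2_inner U (\<lambda>x. H x \<bullet> i) \<phi>)"
    using G H \<phi> i by (simp add: has_weak_gradient_def L2_inner_real)
  also have "\<dots> = - L2_inner U (\<lambda>x. G x \<bullet> i - H x \<bullet> i) \<phi>"
    by (subst L2_inner_diff_left) (auto intro: L2_component test_functions_L2 GL HL \<phi> i \<open>open U\<close>)
  finally show "(LINT x:U|lebesgue. (u x - v x) * partial i \<phi> x)
      = - (LINT x:U|lebesgue. ((G x - H x) \<bullet> i) * \<phi> x)"
    by (simp add: L2_inner_real inner_diff_left)
qed

lemma L2_inner_gradient:
  assumes "open U" and \<phi>: "\<phi> \<in> test_functions U" and G: "G \<in> L2 U"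
  shows "L2_inner U G (gradient \<phi>) = (\<Sum>i\<in>Basis. L2_inner U (\<lambda>x. G x \<bullet> i) (partial i \<phi>))"
proof -
  have int: "set_integrable lebesgue U (\<lambda>x. (G x \<bullet> i) \<bullet> partial i \<phi> x)" if "i \<in> Basis" for i
    using that by (intro set_integrable_inner_L2 L2_component G test_functions_L2
        partial_test_functions \<phi> \<open>open U\<close>)
  have "L2_inner U G (gradient \<phi>)
      = (LINT x|lebesgue. (\<Sum>i\<in>Basis. indicator U x *\<^sub>R ((G x \<bullet> i) \<bullet> partial i \<phi> x)))"
    by (simp add: L2_inner_def set_lebesgue_integral_def gradient_def inner_sum_right
        sum_distrib_left ac_simps)
  also have "\<dots> = (\<Sum>i\<in>Basis. LINT x|lebesgue. indicator U x *\<^sub>R ((G x \<bullet> i) \<bullet> partial i \<phi> x))"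
    using int by (intro Bochner_Integration.integral_sum) (simp add: set_integrable_def)
  finally show ?thesis by (simp add: L2_inner_def set_lebesgue_integral_def)
qed

text \<open>The defining identity of the weak gradient, applied to the test functions \<open>\<partial>\<^sub>i \<phi>\<close> and summed
  over \<open>i\<close>, expresses the left-hand side through \<open>u\<close> alone; it equals \<open>- (u, \<Delta>\<phi>)\<close>.\<close>

lemma has_weak_gradient_inner_gradient_test:
  assumes "open U" and \<phi>: "\<phi> \<in> test_functions U" and G: "has_weak_gradient U u G"
  shows "L2_inner U G (gradient \<phi>)
    = - (\<Sum>i\<in>Basis. L2_inner U u (partial i (partial i \<phi>)))"
proof -
  have "G \<in> L2 U" using G by (simp add: has_weak_gradient_def)
  then have "L2_inner U G (gradient \<phi>) = (\<Sum>i\<in>Basis. L2_inner U (\<lambda>x. G x \<bullet> i) (partial i \<phi>))"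
    by (rule L2_inner_gradient[OF \<open>open U\<close> \<phi>])
  also have "\<dots> = (\<Sum>i\<in>Basis. - L2_inner U u (partial i (partial i \<phi>)))"
    using G partial_test_functions[OF \<phi>]
    by (intro sum.cong refl) (simp add: has_weak_gradient_def L2_inner_real)
  finally show ?thesis by (simp add: sum_negf)
qed

text \<open>\<open>\<nabla>v\<close> is an \<open>L\<^sup>2\<close> limit of gradients of test functions, on which \<open>G\<close> and \<open>H\<close> act alike.\<close>

lemma has_weak_gradient_inner_unique:
  assumes "open U" and G: "has_weak_gradient U u G" and H: "has_weak_gradient U u H"
    and v: "v \<in> H10 U"
  shows "L2_inner U G (weak_gradient U v) = L2_inner U H (weak_gradient U v)"
proof -
  obtain \<phi> where \<phi>: "\<And>n::nat. \<phi> n \<in> test_functions U"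
    and lim: "(\<lambda>n. L2_norm U (\<lambda>x. weak_gradient U v x - gradient (\<phi> n) x)) \<longlonglongrightarrow> 0"
    using v unfolding H10_def by blast
  have vL: "weak_gradient U v \<in> L2 U"
    using v has_weak_gradient_weak_gradient[of v U] by (simp add: H10_def has_weak_gradient_def)
  have conv: "(\<lambda>n. L2_inner U F (gradient (\<phi> n))) \<longlonglongrightarrow> L2_inner U F (weak_gradient U v)"
    if "F \<in> L2 U" for F
    using that vL gradient_test_function_L2[OF \<open>open U\<close> \<phi>] lim by (rule L2_inner_tendsto)
  have "L2_inner U G (gradient (\<phi> n)) = L2_inner U H (gradient (\<phi> n))" for n
    using has_weak_gradient_inner_gradient_test[OF \<open>open U\<close> \<phi>] G H by simp
  then show ?thesis
    using conv[of G] conv[of H] G H by (auto simp: has_weak_gradient_def intro: LIMSEQ_unique)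
qed

text \<open>The selected representatives \<open>weak_gradient U u\<close> need not depend linearly on \<open>u\<close>; tested against
  gradients from \<open>H10 U\<close> they do, because \<open>\<nabla>u - \<nabla>v\<close> is one of the weak gradients of \<open>u - v\<close>.\<close>

lemma weak_gradient_diff_inner:
  assumes "open U" and u: "u \<in> H1 U" and v: "v \<in> H1 U" and z: "z \<in> H10 U"
  shows "L2_inner U (weak_gradient U (\<lambda>x. u x - v x)) (weak_gradient U z)
    = L2_inner U (weak_gradient U u) (weak_gradient U z)
      - L2_inner U (weak_gradient U v) (weak_gradient U z)"
proof -
  note wg = has_weak_gradient_weak_gradient
  have L: "u \<in> L2 U" "v \<in> L2 U" using u v by (auto simp: H1_def)
  have d: "has_weak_gradient U (\<lambda>x. u x - v x) (\<lambda>x. weak_gradient U u x - weak_gradient U v x)"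
    by (intro has_weak_gradient_diff \<open>open U\<close> L wg u v)
  with L have "(\<lambda>x. u x - v x) \<in> H1 U" by (auto simp: H1_def L2_diff)
  then have "L2_inner U (weak_gradient U (\<lambda>x. u x - v x)) (weak_gradient U z)
      = L2_inner U (\<lambda>x. weak_gradient U u x - weak_gradient U v x) (weak_gradient U z)"
    by (intro has_weak_gradient_inner_unique[OF \<open>open U\<close> wg d z])
  also have "\<dots> = L2_inner U (weak_gradient U u) (weak_gradient U z)
      - L2_inner U (weak_gradient U v) (weak_gradient U z)"
    using wg[OF u] wg[OF v] wg[of z U] z
    by (intro L2_inner_diff_left) (auto simp: has_weak_gradient_def H10_def)
  finally show ?thesis .
qed

section \<open>Galerkin orthogonality\<close>

theorem lemma4p1:
  fixes \<Omega> :: "(real ^ 'd) set" and T \<kappa> :: real and k :: nat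
    and f \<psi> \<psi>h w wt \<sigma> W :: "real \<Rightarrow> real ^ 'd \<Rightarrow> real"
    and w0 :: "real ^ 'd \<Rightarrow> real" and \<T> :: "(real ^ 'd) set set"
  assumes "CARD('d) \<in> {2, 3}" and "open \<Omega>" and "bounded \<Omega>" and "T > 0"
    and "f \<in> Bochner_L2_L2 T \<Omega>"
    and "(\<lambda>(x, t). \<psi> t x) \<in> H1 (\<Omega> \<times> {0<..<T})"
    and "H1_nonpos_on (\<Omega> \<times> {0<..<T}) (frontier \<Omega> \<times> {0..T}) (\<lambda>(x, t). \<psi> t x)"
    and "shape_regular_triangulation \<kappa> \<Omega> \<T>" and "k \<ge> 1"
    and "\<forall>t\<in>{0..T}. \<forall>x\<in>frontier \<Omega>. \<psi>h t x \<le> 0"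
    and "w0 \<in> fe_space \<Omega> \<T> k"
    and "semidiscrete_solution \<Omega> T f \<T> k \<psi>h w0 w wt"
    and "discrete_multiplier \<Omega> T f \<T> k w wt \<sigma>"
    and "elliptic_reconstruction \<Omega> T f wt \<sigma> W"
  shows "AE t\<in>{0..T} in lebesgue. \<forall>v\<in>fe_space \<Omega> \<T> k.
    L2_inner \<Omega> (weak_gradient \<Omega> (\<lambda>x. W t x - w t x)) (weak_gradient \<Omega> v) = 0"
proof -
  \<comment> \<open>The Bochner space speaks of the open interval, the conclusion of the closed one; the two
    endpoints form a null set.\<close>
  have "AE t\<in>{0<..<T} in lebesgue. f t \<in> L2 \<Omega>"
    using assms(5) by (simp add: Bochner_L2_L2_def)
  moreover have "AE t in lebesgue. t \<noteq> 0" "AE t in lebesgue. t \<noteq> T"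
    by (simp_all add: AE_completion AE_lborel_singleton)
  ultimately have fL: "AE t\<in>{0..T} in lebesgue. f t \<in> L2 \<Omega>"
    by eventually_elim auto
  have w: "\<forall>t\<in>{0..T}. w t \<in> fe_space \<Omega> \<T> k"
    and wt: "AE t\<in>{0..T} in lebesgue. wt t \<in> fe_space \<Omega> \<T> k"
    using assms(12) by (auto simp: semidiscrete_solution_def constraint_set_def)
  note mult = assms(13)[unfolded discrete_multiplier_def]
  note rec = assms(14)[unfolded elliptic_reconstruction_def]
  have H10: "v \<in> H10 \<Omega>" if "v \<in> fe_space \<Omega> \<T> k" for v
    using that by (simp add: fe_space_def)
  have H1: "v \<in> H1 \<Omega>" and L2: "v \<in> L2 \<Omega>" if "v \<in> H10 \<Omega>" for v
    using that by (simp_all add: H10_def H1_def)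
  from fL wt mult rec show ?thesis
  proof (eventually_elim, intro impI ballI)
    fix t v
    assume t: "t \<in> {0..T}" and v: "v \<in> fe_space \<Omega> \<T> k"
      and "t \<in> {0..T} \<longrightarrow> f t \<in> L2 \<Omega>" and "t \<in> {0..T} \<longrightarrow> wt t \<in> fe_space \<Omega> \<T> k"
      and m: "t \<in> {0..T} \<longrightarrow> \<sigma> t \<in> fe_space \<Omega> \<T> k \<and>
        (\<forall>v\<in>fe_space \<Omega> \<T> k. L2_inner \<Omega> (\<sigma> t) v =
          L2_inner \<Omega> (wt t) v + dirichlet_form \<Omega> (w t) v - L2_inner \<Omega> (f t) v)"
      and r: "t \<in> {0..T} \<longrightarrow> W t \<in> H10 \<Omega> \<and>
        (\<forall>v\<in>H10 \<Omega>. L2_inner \<Omega> (weak_gradient \<Omega> (W t)) (weak_gradient \<Omega> v) =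
          L2_inner \<Omega> (\<lambda>x. f t x + \<sigma> t x - wt t x) v)"
    then have L: "f t \<in> L2 \<Omega>" "\<sigma> t \<in> L2 \<Omega>" "wt t \<in> L2 \<Omega>" "v \<in> L2 \<Omega>"
      using H10 L2 by auto
    have "L2_inner \<Omega> (weak_gradient \<Omega> (W t)) (weak_gradient \<Omega> v)
        = L2_inner \<Omega> (\<lambda>x. f t x + \<sigma> t x - wt t x) v"
      using r t H10[OF v] by blast
    also have "\<dots> = L2_inner \<Omega> (f t) v + L2_inner \<Omega> (\<sigma> t) v - L2_inner \<Omega> (wt t) v"
      using L by (simp add: L2_inner_diff_left L2_inner_add_left L2_add)
    also have "\<dots> = L2_inner \<Omega> (weak_gradient \<Omega> (w t)) (weak_gradient \<Omega> v)"
      using m t v by (simp add: dirichlet_form_def)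
    finally show "L2_inner \<Omega> (weak_gradient \<Omega> (\<lambda>x. W t x - w t x)) (weak_gradient \<Omega> v) = 0"
      using weak_gradient_diff_inner[OF \<open>open \<Omega>\<close>, of "W t" "w t" v] r t w v H1 H10 by simp
  qed
qed

end
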